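(* Let $m\geqslant 2$ be an integer, and define $n_2=13$, $n_3=17$, $n_4=23$, and $n_m=4m-1$ for $m\geqslant 5$. Then for all positive integers $w,z\geqslant m$ with $w+z\geqslant n_m$, we have $b_m(w)\,b_m(z)>b_m(w+z)$.
   Context: For an integer $m\geqslant2$, the $m$-ary partition function $b_m(n)$ is the number of partitions of $n$ all of whose parts belong to $\{1,m,m^2,m^3,\ldots\}$. *)

theory Defs
  imports Main "HOL-Library.Multiset"
begin

text \<open>A partition of \<^term>\<open>n\<close> is the multiset of its parts. For \<^prop>\<open>m \<ge> 2\<close> all powers of
  \<^term>\<open>m\<close> are positive, so the set of partitions below is finite and \<^const>\<open>card\<close> is the true count
  (lemma \<open>finite_mary_partitions\<close>).\<close>

definition mary_partitions :: "nat \<Rightarrow> nat \<Rightarrow> nat multiset set" where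
  "mary_partitions m n = {P. set_mset P \<subseteq> range (\<lambda>k. m ^ k) \<and> sum_mset P = n}"

definition mary_partition_count :: "nat \<Rightarrow> nat \<Rightarrow> nat" where
  "mary_partition_count m n = card (mary_partitions m n)"

definition mary_threshold :: "nat \<Rightarrow> nat" where
  "mary_threshold m = (if m = 2 then 13 else if m = 3 then 17 else if m = 4 then 23 else 4 * m - 1)"

lemma finite_mary_partitions:
  assumes "m \<ge> 2"
  shows "finite (mary_partitions m n)"
proof (rule finite_subset)
  show "mary_partitions m n \<subseteq> mset ` {xs. set xs \<subseteq> {..n} \<and> length xs \<le> n}"
  proof
    fix P assume "P \<in> mary_partitions m n"
    then have pow: "set_mset P \<subseteq> range (\<lambda>k. m ^ k)" and sum: "sum_mset P = n"
      by (auto simp: mary_partitions_def)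
    have pos: "x \<ge> 1" if "x \<in># P" for x
      using that pow assms by (auto simp: Suc_le_eq)
    have "size P \<le> sum_mset P"
      using pos
    proof (induction P)
      case (add x P)
      then have "size P \<le> sum_mset P" "x \<ge> 1" by auto
      then show ?case by simp
    qed simp
    then have size: "size P \<le> n" using sum by simp
    have le: "x \<le> n" if "x \<in># P" for x
      using that sum by (metis le_add1 multi_member_split sum_mset.add_mset)
    obtain xs where "mset xs = P" using ex_mset by blast
    with size le show "P \<in> mset ` {xs. set xs \<subseteq> {..n} \<and> length xs \<le> n}"
      by (auto intro!: image_eqI[of _ _ xs])
  qed
  show "finite (mset ` {xs. set xs \<subseteq> {..n} \<and> length xs \<le> n})"
    by (intro finite_imageI finite_lists_length_le) simp
qed

end

theory Submission imports Defs begin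

text \<open>
  Write \<open>c k = b\<^sub>m (m k)\<close>. Splitting partitions according to whether \<open>1\<close> is a part gives
  \<open>b\<^sub>m n = c (n div m)\<close> and \<open>c (k + 1) = c k + c ((k + 1) div m)\<close>. This recurrence yields first
  \<open>c (a + b) \<le> c a * c b\<close>, and then shows that \<open>c (a + b + 1) < c a * c b\<close> is inherited from
  \<open>(a, b)\<close> by \<open>(a, b + 1)\<close> whenever \<open>a \<ge> 1\<close>: the increment \<open>c ((a + b + 2) div m)\<close> of the left side
  is at most \<open>c (a + (b + 1) div m)\<close>, hence at most the increment \<open>c a * c ((b + 1) div m)\<close> of the
  right side. It remains to check the finitely many pairs with \<open>a + b\<close> minimal for the given
  threshold; the extra \<open>1\<close> absorbs the carry in \<open>(w + z) div m\<close>.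
\<close>

section \<open>Partitions with and without the part 1\<close>

lemma mary_partitions_0:
  assumes "m \<ge> 2"
  shows "mary_partitions m 0 = {{#}}"
proof -
  have "P = {#}" if "P \<in> mary_partitions m 0" for P
  proof (rule ccontr)
    assume "P \<noteq> {#}"
    then obtain x where "x \<in># P" by blast
    with that assms show False
      by (auto simp: mary_partitions_def)
  qed
  then show ?thesis by (auto simp: mary_partitions_def)
qed

lemma mary_partitions_with_1:
  "{P \<in> mary_partitions m (Suc n). 1 \<in># P} = add_mset 1 ` mary_partitions m n"
proof (intro equalityI subsetI)
  fix P assume P: "P \<in> {P \<in> mary_partitions m (Suc n). 1 \<in># P}"
  then obtain Q where Q: "P = add_mset 1 Q" by (blast dest: multi_member_split)
  with P show "P \<in> add_mset 1 ` mary_partitions m n"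
    by (auto simp: mary_partitions_def)
next
  fix P assume "P \<in> add_mset 1 ` mary_partitions m n"
  moreover have "1 \<in> range (\<lambda>k. m ^ k)" using rangeI[of "\<lambda>k. m ^ k" 0] by simp
  ultimately show "P \<in> {P \<in> mary_partitions m (Suc n). 1 \<in># P}"
    by (auto simp: mary_partitions_def)
qed

lemma sum_mset_image_mult: "sum_mset (image_mset ((*) m) P) = m * sum_mset P" for m :: nat
  by (induction P) (simp_all add: algebra_simps)

text \<open>Without the part 1 every part is a positive power of \<open>m\<close>, so dividing all
  parts by \<open>m\<close> inverts scaling by \<open>m\<close>; this also forces \<open>m\<close>
  to divide \<open>n\<close>.\<close>

lemma mary_partitions_without_1:
  assumes "m \<ge> 2"
  shows "{P \<in> mary_partitions m n. 1 \<notin># P} =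
    (if m dvd n then image_mset ((*) m) ` mary_partitions m (n div m) else {})" (is "?A = ?B")
proof -
  have eq: "P \<in> image_mset ((*) m) ` mary_partitions m (n div m) \<and> m dvd n" if P: "P \<in> ?A" for P
  proof -
    have part: "\<exists>k. x = m * m ^ k" if x: "x \<in># P" for x
    proof -
      obtain k where "x = m ^ k" using x P unfolding mary_partitions_def by blast
      \<comment> \<open>The case \<open>k = 0\<close> would make \<open>x\<close> the excluded part
        1.\<close>
      then show ?thesis using x P by (cases k) auto
    qed
    define Q where "Q = image_mset (\<lambda>x. x div m) P"
    have "m * (x div m) = x" if "x \<in># P" for x
      using part[OF that] by auto
    then have "image_mset (\<lambda>x. m * (x div m)) P = image_mset (\<lambda>x. x) P"
      by (intro image_mset_cong)
    then have PQ: "P = image_mset ((*) m) Q"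
      by (simp add: Q_def multiset.map_comp comp_def)
    have n: "n = m * sum_mset Q"
      using P PQ by (auto simp: mary_partitions_def sum_mset_image_mult)
    have "x div m \<in> range (\<lambda>k. m ^ k)" if "x \<in># P" for x
      using part[OF that] assms by auto
    then have "set_mset Q \<subseteq> range (\<lambda>k. m ^ k)"
      by (auto simp: Q_def)
    then have "Q \<in> mary_partitions m (n div m)"
      using n assms by (simp add: mary_partitions_def)
    then show ?thesis using PQ n by auto
  qed
  have "image_mset ((*) m) Q \<in> ?A" if Q: "Q \<in> mary_partitions m (n div m)" and "m dvd n" for Q
  proof -
    have "m * m ^ k \<in> range (\<lambda>k. m ^ k)" for k
      using rangeI[of "\<lambda>k. m ^ k" "Suc k"] by simp
    then have "set_mset (image_mset ((*) m) Q) \<subseteq> range (\<lambda>k. m ^ k)"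
      using Q by (auto simp: mary_partitions_def)
    moreover have "1 \<notin># image_mset ((*) m) Q" using assms by auto
    ultimately show ?thesis
      using that by (simp add: mary_partitions_def sum_mset_image_mult)
  qed
  with eq show ?thesis by auto
qed

lemma mary_partition_count_0: "m \<ge> 2 \<Longrightarrow> mary_partition_count m 0 = 1"
  by (simp add: mary_partition_count_def mary_partitions_0)

lemma mary_partition_count_Suc:
  assumes "m \<ge> 2"
  shows "mary_partition_count m (Suc n) = mary_partition_count m n +
    (if m dvd Suc n then mary_partition_count m (Suc n div m) else 0)"
proof -
  let ?A = "{P \<in> mary_partitions m (Suc n). 1 \<in># P}"
  let ?B = "{P \<in> mary_partitions m (Suc n). 1 \<notin># P}"
  have "mary_partitions m (Suc n) = ?A \<union> ?B" by auto
  moreover have "finite ?A" "finite ?B" "?A \<inter> ?B = {}"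
    using finite_mary_partitions[OF assms] by auto
  ultimately have "mary_partition_count m (Suc n) = card ?A + card ?B"
    unfolding mary_partition_count_def by (metis card_Un_disjoint)
  moreover have "card ?A = mary_partition_count m n"
    unfolding mary_partitions_with_1 mary_partition_count_def
    by (intro card_image) (auto intro: inj_onI)
  moreover have "inj (image_mset ((*) m))"
    using assms by (intro multiset.inj_map) (auto intro: injI)
  then have "card ?B = (if m dvd Suc n then mary_partition_count m (Suc n div m) else 0)"
    unfolding mary_partitions_without_1[OF assms] mary_partition_count_def
    by (auto intro!: card_image intro: inj_on_subset)
  ultimately show ?thesis by simp
qed

section \<open>Counts at multiples of \<open>m\<close>\<close>

definition mary_count_mult :: "nat \<Rightarrow> nat \<Rightarrow> nat" where
  "mary_count_mult m k = mary_partition_count m (m * k)"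

text \<open>Between consecutive multiples of \<open>m\<close> the second summand of the recurrence
  vanishes, so the count stays constant there.\<close>

lemma mary_partition_count_eq_mult:
  assumes "m \<ge> 2"
  shows "mary_partition_count m n = mary_count_mult m (n div m)"
proof (induction n)
  case (Suc n)
  show ?case
  proof (cases "m dvd Suc n")
    case False
    then have "Suc n div m = n div m" by (simp add: div_Suc dvd_eq_mod_eq_0)
    with Suc False show ?thesis by (simp add: mary_partition_count_Suc[OF assms])
  qed (simp add: mary_count_mult_def)
qed (simp add: mary_count_mult_def)

lemma mary_count_mult_0: "m \<ge> 2 \<Longrightarrow> mary_count_mult m 0 = 1"
  by (simp add: mary_count_mult_def mary_partition_count_0)

lemma mary_count_mult_Suc:
  assumes "m \<ge> 2"
  shows "mary_count_mult m (Suc k) = mary_count_mult m k + mary_count_mult m (Suc k div m)"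
proof -
  \<comment> \<open>The last number before the multiple \<open>m * Suc k\<close>, where the count is
    still \<open>mary_count_mult m k\<close>.\<close>
  let ?n = "m * k + (m - 1)"
  have "Suc ?n = m * Suc k" using assms by simp
  moreover have "?n div m = k" using assms by (intro div_nat_eqI) auto
  ultimately show ?thesis
    using mary_partition_count_Suc[OF assms, of ?n] assms
    by (simp add: mary_partition_count_eq_mult del: mult_Suc_right)
qed

lemma mary_count_mult_mono:
  assumes "m \<ge> 2" "i \<le> j"
  shows "mary_count_mult m i \<le> mary_count_mult m j"
  by (rule lift_Suc_mono_le[of "mary_count_mult m"]) (simp_all add: assms mary_count_mult_Suc)

section \<open>Comparing sums of indices with products of counts\<close>

lemma mary_count_mult_add_le:
  assumes "m \<ge> 2"
  shows "mary_count_mult m (a + b) \<le> mary_count_mult m a * mary_count_mult m b"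
proof (induction b rule: less_induct)
  case (less b)
  show ?case
  proof (cases b)
    case 0
    then show ?thesis by (simp add: mary_count_mult_0 assms)
  next
    case (Suc b')
    \<comment> \<open>Replacing \<open>a\<close> by the larger \<open>m * a\<close> lets it leave
      the quotient, so the induction hypothesis applies at \<open>b div m < b\<close>.\<close>
    have "Suc (a + b') div m \<le> (m * a + b) div m"
      using assms Suc by (intro div_le_mono) simp
    also have "\<dots> = a + b div m" using assms by simp
    finally have "mary_count_mult m (Suc (a + b') div m) \<le> mary_count_mult m (a + b div m)"
      using mary_count_mult_mono assms by blast
    also have "\<dots> \<le> mary_count_mult m a * mary_count_mult m (b div m)"
      using assms Suc by (intro less) simp
    finally show ?thesis
      using less[of b'] Suc by (simp add: mary_count_mult_Suc assms algebra_simps)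
  qed
qed

lemma mary_count_mult_less_step:
  assumes "m \<ge> 2" "a \<ge> 1"
    and "mary_count_mult m (Suc (a + b)) < mary_count_mult m a * mary_count_mult m b"
  shows "mary_count_mult m (Suc (a + Suc b)) < mary_count_mult m a * mary_count_mult m (Suc b)"
proof -
  \<comment> \<open>The slack between \<open>a\<close> and \<open>m * a\<close> absorbs the extra 1
    in the index; this is where \<open>a \<ge> 1\<close> enters.\<close>
  have "a + 1 \<le> m * a" using assms(2) mult_le_mono1[OF assms(1), of a] by linarith
  then have "Suc (Suc (a + b)) div m \<le> (m * a + Suc b) div m"
    by (intro div_le_mono) simp
  also have "\<dots> = a + Suc b div m" using assms by (simp del: add_Suc_right)
  finally have "mary_count_mult m (Suc (Suc (a + b)) div m) \<le> mary_count_mult m (a + Suc b div m)"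
    using mary_count_mult_mono assms by blast
  also have "\<dots> \<le> mary_count_mult m a * mary_count_mult m (Suc b div m)"
    using assms by (intro mary_count_mult_add_le)
  finally show ?thesis
    using assms by (simp add: mary_count_mult_Suc[of m "Suc (a + b)"] mary_count_mult_Suc[of m b]
        algebra_simps)
qed

text \<open>Induction on the sum of the indices, always lowering the larger one; by symmetry only
  ordered pairs need a base case.\<close>

lemma mary_count_mult_less_from:
  assumes "m \<ge> 2" "K \<ge> 2"
    and base: "\<And>a b. \<lbrakk>1 \<le> a; a \<le> b; a + b = K\<rbrakk> \<Longrightarrow>
      mary_count_mult m (Suc (a + b)) < mary_count_mult m a * mary_count_mult m b"
    and "1 \<le> a" "1 \<le> b" "K \<le> a + b"
  shows "mary_count_mult m (Suc (a + b)) < mary_count_mult m a * mary_count_mult m b"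
proof -
  have "mary_count_mult m (Suc (a + b)) < mary_count_mult m a * mary_count_mult m b"
    if "K \<le> s" "1 \<le> a" "a \<le> b" "s = a + b" for s a b
    using that
  proof (induction s arbitrary: a b rule: dec_induct)
    case base
    then show ?case using assms(3)[of a b] by simp
  next
    case (step s)
    then obtain b' where b: "b = Suc b'" by (cases b) auto
    have "mary_count_mult m (Suc (a + b')) < mary_count_mult m a * mary_count_mult m b'"
    proof (cases "a \<le> b'")
      case True
      with step b show ?thesis by simp
    next
      \<comment> \<open>Here \<open>a = b\<close>, so lowering \<open>b\<close> breaks the order and
        the pair is swapped. The sum is at least 3 because \<open>K \<ge> 2\<close>, which gives
        \<open>b' \<ge> 1\<close>.\<close>
      case False
      with step b \<open>K \<ge> 2\<close>
      have "mary_count_mult m (Suc (b' + a)) < mary_count_mult m b' * mary_count_mult m a"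
        by (intro step.IH) auto
      then show ?thesis by (simp add: ac_simps)
    qed
    then show ?case using mary_count_mult_less_step[OF \<open>m \<ge> 2\<close> \<open>1 \<le> a\<close>] b by simp
  qed
  note ordered = this[OF \<open>K \<le> a + b\<close>]
  show ?thesis
  proof (cases "a \<le> b")
    case True
    then show ?thesis using ordered[of a b] assms(4) by simp
  next
    case False
    then show ?thesis using ordered[of b a] assms(5) by (simp add: add.commute mult.commute)
  qed
qed

text \<open>The bounds on \<open>a + b\<close> are the least possible: one lower, equality occurs at
  the pairs (1,4), (2,2), (1,3), (1,1) for \<open>m = 2\<close>, \<open>m = 3\<close>,
  \<open>m = 4\<close>, \<open>m \<ge> 5\<close> respectively.\<close>

lemma mary_count_mult_less:
  assumes "m \<ge> 2" "1 \<le> a" "1 \<le> b"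
    and "a + b \<ge> (if m = 2 then 6 else if m = 3 \<or> m = 4 then 5 else 3)"
  shows "mary_count_mult m (Suc (a + b)) < mary_count_mult m a * mary_count_mult m b"
proof (rule mary_count_mult_less_from[OF assms(1) _ _ assms(2-4)])
  fix a b :: nat
  assume ab: "1 \<le> a" "a \<le> b" "a + b = (if m = 2 then 6 else if m = 3 \<or> m = 4 then 5 else 3)"
  consider "m = 2" | "m = 3" | "m = 4" | "m \<ge> 5" using assms(1) by linarith
  then show "mary_count_mult m (Suc (a + b)) < mary_count_mult m a * mary_count_mult m b"
  proof cases
    case 1
    \<comment> \<open>The values at 0 to 7 are 1, 2, 4, 6, 10, 14, 20, 26, and 26 is below 2*14,
      4*10 and 6*6.\<close>
    then have "a = 1 \<and> b = 5 \<or> a = 2 \<and> b = 4 \<or> a = 3 \<and> b = 3" using ab by auto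
    then show ?thesis using 1 mary_count_mult_Suc[of 2 0] mary_count_mult_Suc[of 2 1] mary_count_mult_Suc[of 2 2]
        mary_count_mult_Suc[of 2 3] mary_count_mult_Suc[of 2 4] mary_count_mult_Suc[of 2 5]
        mary_count_mult_Suc[of 2 6]
      by (auto simp: mary_count_mult_0 numeral_2_eq_2[symmetric])
  next
    case 2
    then have "a = 1 \<and> b = 4 \<or> a = 2 \<and> b = 3" using ab by auto
    then show ?thesis using 2 mary_count_mult_Suc[of 3 0] mary_count_mult_Suc[of 3 1] mary_count_mult_Suc[of 3 2]
        mary_count_mult_Suc[of 3 3] mary_count_mult_Suc[of 3 4] mary_count_mult_Suc[of 3 5]
      by (auto simp: mary_count_mult_0 numeral_2_eq_2[symmetric])
  next
    case 3
    then have "a = 1 \<and> b = 4 \<or> a = 2 \<and> b = 3" using ab by auto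
    then show ?thesis using 3 mary_count_mult_Suc[of 4 0] mary_count_mult_Suc[of 4 1] mary_count_mult_Suc[of 4 2]
        mary_count_mult_Suc[of 4 3] mary_count_mult_Suc[of 4 4] mary_count_mult_Suc[of 4 5]
      by (auto simp: mary_count_mult_0 numeral_2_eq_2[symmetric])
  next
    case 4
    \<comment> \<open>The value at each \<open>k \<le> 4\<close> is \<open>k + 1\<close>, so the
      claim is 5 < 2*3.\<close>
    then have "a = 1 \<and> b = 2" using ab by auto
    then show ?thesis using 4 mary_count_mult_Suc[of m 0] mary_count_mult_Suc[of m 1]
        mary_count_mult_Suc[of m 2] mary_count_mult_Suc[of m 3]
      by (auto simp: mary_count_mult_0 numeral_2_eq_2[symmetric])
  qed
qed (use assms in simp_all)

theorem theorem4p4: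
  fixes m w z :: nat
  assumes "m \<ge> 2"
    and "w > 0" and "z > 0"
    and "w \<ge> m" and "z \<ge> m"
    and "w + z \<ge> mary_threshold m"
  shows "mary_partition_count m w * mary_partition_count m z > mary_partition_count m (w + z)"
proof -
  define a b where "a = w div m" and "b = z div m"
  have wa: "w \<le> m * a + (m - 1)" and zb: "z \<le> m * b + (m - 1)"
    using assms(1) mod_less_divisor[of m w] mod_less_divisor[of m z]
      mult_div_mod_eq[of m w] mult_div_mod_eq[of m z]
    unfolding a_def b_def by linarith+
  have ab: "1 \<le> a" "1 \<le> b"
    using assms by (auto simp: a_def b_def Suc_le_eq div_greater_zero_iff)
  \<comment> \<open>Both remainders are at most \<open>m - 1\<close>, which leaves a slack of
    2.\<close>
  have wz: "w + z + 2 \<le> m * (a + b + 2)"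
    using wa zb assms(1) by (simp add: algebra_simps)
  \<comment> \<open>A smaller \<open>a + b\<close> would give \<open>w + z\<close> at most 12, 16,
    22 or \<open>4 * m - 2\<close> in the four cases, one below
    \<open>mary_threshold m\<close>.\<close>
  have "a + b \<ge> (if m = 2 then 6 else if m = 3 \<or> m = 4 then 5 else 3)"
  proof (rule ccontr)
    assume "\<not> ?thesis"
    then have "m * (a + b + 2) \<le> m * (if m = 2 then 7 else if m = 3 \<or> m = 4 then 6 else 4)"
      by (intro mult_le_mono) auto
    with wz have "w + z + 2 \<le> m * (if m = 2 then 7 else if m = 3 \<or> m = 4 then 6 else 4)"
      by (rule order_trans)
    with assms(1,6) show False by (auto simp: mary_threshold_def split: if_splits)
  qed
  with assms(1) ab have "mary_count_mult m (Suc (a + b)) < mary_count_mult m a * mary_count_mult m b"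
    by (intro mary_count_mult_less)
  moreover have "(w + z) div m < a + b + 2"
    using wz assms(1) by (intro less_mult_imp_div_less) (simp add: algebra_simps)
  then have "mary_count_mult m ((w + z) div m) \<le> mary_count_mult m (Suc (a + b))"
    using assms(1) by (intro mary_count_mult_mono) auto
  ultimately show ?thesis
    using assms(1) by (simp add: mary_partition_count_eq_mult a_def b_def)
qed

end
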